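(* Let $A\in\mathbb{R}^{n\times n}$ be nonsingular with $m$ the maximum number of nonzero entries per row, and let $B\in\mathbb{R}^{n\times s}$. Let $X_0=O$ and $R_0=B-AX_0=B$. In finite precision arithmetic (in the model described in the context), let $X_k\in\mathbb{F}^{n\times s}$ and $R_k\in\mathbb{F}^{n\times s}$ be the $k$th approximation and residual generated for $k\ge 1$ by the recursion formulas $$X_k = X_{k-1}+\widehat{Q}_{k-1}\alpha_{k-1}^\square,\qquad R_k=R_{k-1}-(A\widehat{Q}_{k-1})\alpha_{k-1}^\square,$$ with $\alpha_{k-1}^\square\in\mathbb{F}^{s\times s}$, that is, $X_k=\mathrm{fl}(X_{k-1}+\mathrm{fl}(\widehat{Q}_{k-1}\alpha_{k-1}^\square))$ and $R_k=\mathrm{fl}(R_{k-1}-\mathrm{fl}(\mathrm{fl}(A\widehat{Q}_{k-1})\alpha_{k-1}^\square))$, where $\widehat{Q}_{k-1}$ is the numerically computed Q-factor of the direction matrix $P_{k-1}\in\mathbb{R}^{n\times s}$ obtained from the QR decomposition with Givens rotations or Householder transformations. Assume that $$\begin{cases} c\left[(n+2(s-1))(\sqrt{s}+1)+1\right]\mathbf{u}<\frac12 & \text{for Givens},\\ c\left[(n+1)(\sqrt{s}+1)s+1\right]\mathbf{u}<\frac12 & \text{for Householder}.\end{cases}$$ Then, for $k\ge 1$, the norm of the residual gap $G_{R_k}:=(B-AX_k)-R_k$ (evaluated exactly) is bounded as $$\|G_{R_k}\| < \left(8\sqrt{s}\,\gamma_{m+3s}+\gamma_1\right)k\,\|A\|\max_{0<i\le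 k}\|X_i\| + k\,\gamma_1\max_{0<i\le k}\|R_i\|.$$
   Context: Here $1\le s\le n$ and $1\le m\le n$ are integers. $\mathbb{F}\subset\mathbb{R}$ is the set of floating point numbers, $\mathrm{fl}(\cdot)$ is the result of floating point operations, $\mathbf{u}$ is the unit roundoff, $\|\cdot\|$ is the Frobenius norm, and $\|\cdot\|_2$ is the Euclidean norm of a vector. Put $\gamma_k:=\dfrac{k\mathbf{u}}{1-k\mathbf{u}}$ and $\tilde\gamma_k:=\dfrac{ck\mathbf{u}}{1-ck\mathbf{u}}$, where $c$ is a small integer constant greater than one. Whenever $\gamma_k$ (respectively $\tilde\gamma_k$) is used, $k\mathbf{u}<1$ (respectively $ck\mathbf{u}<1$) is implicitly assumed. Error model for matrix operations: for $P,Q\in\mathbb{F}^{n\times s}$ and $\alpha^\square\in\mathbb{F}^{s\times s}$, $\mathrm{fl}(P\pm Q)=P\pm Q+E'$ with $\|E'\|\le\mathbf{u}\|P\pm Q\|$; $\mathrm{fl}(P\alpha^\square)=P\alpha^\square+E^\square$ with $\|E^\square\|\le\gamma_s\|P\|\|\alpha^\square\|$; $\mathrm{fl}(AP)=AP+E'''$ with $\|E'''\|\le\gamma_m\|A\|\|P\|$. Error model for the computed Q-factor (known backward error results for Givens and Householder QR, used as a hypothesis): for each $k\ge1$ the computed $\widehat{Q}_{k-1}\in\mathbb{F}^{n\times s}$ satisfies $$\widehat{Q}_{k-1}=Q_{k-1}\left(\begin{bmatrix}I_s\\O\end{bmatrix}+\Delta I_{k-1}\right),\qquad \Delta I_{k-1}\in\mathbb{R}^{n\times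 s},$$ where $Q_{k-1}\in\mathbb{R}^{n\times n}$ is an exactly orthogonal matrix (the product of the Givens rotations or Householder transformations, the Q-factor of the full QR decomposition of $P_{k-1}$), and where, for $j=1,\dots,s$, the $j$th column of $\Delta I_{k-1}$ satisfies $\|\Delta I_{k-1}(:,j)\|_2\le\tilde\gamma_{n+s-2}$ for Givens rotations and $\|\Delta I_{k-1}(:,j)\|_2\le\tilde\gamma_{ns}$ for Householder transformations.
   Formalization: The strict inequality is proved when some X_i with 0 < i ≤ k is nonzero; if all these X_i vanish only ≤ is claimed, since for B = O with all α = O both sides are 0; the subtraction error model is also assumed for the real matrix B as left operand. *)

theory Defs
  imports "HOL-Analysis.Analysis"
begin

text \<open>
  Real matrices with rows indexed by \<open>'r\<close> and columns indexed by \<open>'c\<close>, also written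
  \<^typ>\<open>real^'c^'r\<close>; thus \<open>n = CARD('n)\<close> and \<open>s = CARD('s)\<close> for \<open>('n, 's) rmat\<close>. The library norm
  on this type is the Frobenius norm. Where the position of an index matters, the index types are
  linearly ordered.
\<close>

type_synonym ('r, 'c) rmat = "((real, 'c) vec, 'r) vec"

definition gam :: "real \<Rightarrow> nat \<Rightarrow> real" where
  "gam u k = real k * u / (1 - real k * u)"

definition gam_tilde :: "nat \<Rightarrow> real \<Rightarrow> nat \<Rightarrow> real" where
  "gam_tilde c u k = real c * real k * u / (1 - real c * real k * u)"

definition max_row_nonzeros :: "('r::finite, 'c::finite) rmat \<Rightarrow> nat" where
  "max_row_nonzeros A = (MAX i. card {j. A $ i $ j \<noteq> 0})"

definition fp_matrices :: "real set \<Rightarrow> ('r::finite, 'c::finite) rmat set" where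
  "fp_matrices F = {M. \<forall>i j. M $ i $ j \<in> F}"

text \<open>
  \<open>fl_add P Q\<close>, \<open>fl_sub P Q\<close>, \<open>fl_mul P \<alpha>\<close> and \<open>fl_lmul P\<close> are the computed values of \<open>P + Q\<close>,
  \<open>P - Q\<close>, \<open>P \<alpha>\<close> and \<open>A P\<close>. As \<open>B\<close> is a real matrix that occurs as the initial residual, it is
  admitted as the left operand of a subtraction even if its entries are not in \<open>F\<close>.
\<close>

definition fl_error_model ::
  "real set \<Rightarrow> real \<Rightarrow> ('n::finite, 'n) rmat \<Rightarrow> ('n, 's::finite) rmat \<Rightarrow>
   (('n, 's) rmat \<Rightarrow> ('n, 's) rmat \<Rightarrow> ('n, 's) rmat) \<Rightarrow>
   (('n, 's) rmat \<Rightarrow> ('n, 's) rmat \<Rightarrow> ('n, 's) rmat) \<Rightarrow>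
   (('n, 's) rmat \<Rightarrow> ('s, 's) rmat \<Rightarrow> ('n, 's) rmat) \<Rightarrow>
   (('n, 's) rmat \<Rightarrow> ('n, 's) rmat) \<Rightarrow> bool" where
  "fl_error_model F u A B fl_add fl_sub fl_mul fl_lmul \<longleftrightarrow>
     (\<forall>P \<in> fp_matrices F. \<forall>Q \<in> fp_matrices F.
        fl_add P Q \<in> fp_matrices F \<and>
        (\<exists>E. fl_add P Q = P + Q + E \<and> norm E \<le> u * norm (P + Q))) \<and>
     (\<forall>P \<in> insert B (fp_matrices F). \<forall>Q \<in> fp_matrices F.
        fl_sub P Q \<in> fp_matrices F \<and>
        (\<exists>E. fl_sub P Q = P - Q + E \<and> norm E \<le> u * norm (P - Q))) \<and>
     (\<forall>P \<in> fp_matrices F. \<forall>\<alpha> \<in> fp_matrices F.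
        fl_mul P \<alpha> \<in> fp_matrices F \<and>
        (\<exists>E. fl_mul P \<alpha> = P ** \<alpha> + E \<and> norm E \<le> gam u CARD('s) * norm P * norm \<alpha>)) \<and>
     (\<forall>P \<in> fp_matrices F.
        fl_lmul P \<in> fp_matrices F \<and>
        (\<exists>E. fl_lmul P = A ** P + E \<and>
             norm E \<le> gam u (max_row_nonzeros A) * norm A * norm P))"

datatype qr_method = Givens | Householder

definition givens_rotation :: "('n::finite, 'n) rmat \<Rightarrow> bool" where
  "givens_rotation G \<longleftrightarrow> (\<exists>p q c d. p \<noteq> q \<and> c\<^sup>2 + d\<^sup>2 = 1 \<and>
     G = (\<chi> i j. if i = p \<and> j = p \<or> i = q \<and> j = q then c
                 else if i = p \<and> j = q then d
                 else if i = q \<and> j = p then - d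
                 else if i = j then 1 else 0))"

definition householder_reflection :: "('n::finite, 'n) rmat \<Rightarrow> bool" where
  "householder_reflection H \<longleftrightarrow>
     (\<exists>v. v \<noteq> 0 \<and> H = mat 1 - (2 / (v \<bullet> v)) *\<^sub>R (\<chi> i j. v $ i * v $ j))"

fun qr_transformation :: "qr_method \<Rightarrow> ('n::finite, 'n) rmat \<Rightarrow> bool" where
  "qr_transformation Givens = givens_rotation"
| "qr_transformation Householder = householder_reflection"

text \<open>Zero-based position of an index in its index type.\<close>

definition pos :: "'a::{finite,linorder} \<Rightarrow> nat" where
  "pos i = card {j. j < i}"

text \<open>The block matrix with \<open>I\<^sub>s\<close> on top of the zero matrix (for \<open>s \<le> n\<close>).\<close>

definition id_over_zero :: "('n::{finite,linorder}, 's::{finite,linorder}) rmat" where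
  "id_over_zero = (\<chi> i j. if pos i = pos j then 1 else 0)"

definition upper_triangular ::
    "('n::{finite,linorder}, 's::{finite,linorder}) rmat \<Rightarrow> bool" where
  "upper_triangular T \<longleftrightarrow> (\<forall>i j. pos j < pos i \<longrightarrow> T $ i $ j = 0)"

definition full_Q_factor ::
    "qr_method \<Rightarrow> ('n::{finite,linorder}, 's::{finite,linorder}) rmat \<Rightarrow>
     ('n, 'n) rmat \<Rightarrow> bool" where
  "full_Q_factor meth P Q \<longleftrightarrow>
     orthogonal_matrix Q \<and>
     (\<exists>Hs. (\<forall>H \<in> set Hs. qr_transformation meth H) \<and> Q = foldr (**) Hs (mat 1)) \<and>
     (\<exists>T. upper_triangular T \<and> P = Q ** T)"

fun q_error_index :: "qr_method \<Rightarrow> nat \<Rightarrow> nat \<Rightarrow> nat" where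
  "q_error_index Givens n s = n + s - 2"
| "q_error_index Householder n s = n * s"

definition computed_Q_factor ::
    "qr_method \<Rightarrow> nat \<Rightarrow> real \<Rightarrow> ('n::{finite,linorder}, 's::{finite,linorder}) rmat \<Rightarrow>
     ('n, 's) rmat \<Rightarrow> bool" where
  "computed_Q_factor meth c u P Qh \<longleftrightarrow>
     (\<exists>Q \<Delta>. full_Q_factor meth P Q \<and> Qh = Q ** (id_over_zero + \<Delta>) \<and>
        (\<forall>j. norm (column j \<Delta>) \<le> gam_tilde c u (q_error_index meth CARD('n) CARD('s))))"

fun roundoff_condition :: "qr_method \<Rightarrow> nat \<Rightarrow> nat \<Rightarrow> nat \<Rightarrow> real \<Rightarrow> bool" where
  "roundoff_condition Givens n s c u \<longleftrightarrow>
     real c * ((real n + 2 * (real s - 1)) * (sqrt (real s) + 1) + 1) * u < 1 / 2"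
| "roundoff_condition Householder n s c u \<longleftrightarrow>
     real c * ((real n + 1) * (sqrt (real s) + 1) * real s + 1) * u < 1 / 2"

definition residual_gap ::
    "('n::finite, 'n) rmat \<Rightarrow> ('n, 's::finite) rmat \<Rightarrow> ('n, 's) rmat \<Rightarrow> ('n, 's) rmat \<Rightarrow> ('n, 's) rmat" where
  "residual_gap A B X R = (B - A ** X) - R"

end

theory Submission
  imports Defs
begin

text \<open>
  One step of the recursions changes the residual gap only by rounding errors, because the exact
  updates \<open>Q \<alpha>\<close> of \<open>X\<close> and \<open>A Q \<alpha>\<close> of \<open>R\<close> cancel in \<open>B - A X - R\<close>. There are two kinds of errors.

  The errors of the two additions are relative to the computed sums, so they contribute
  \<open>\<gamma>\<^sub>1 \<parallel>A\<parallel> \<parallel>X\<^sub>k\<parallel>\<close> and \<open>\<gamma>\<^sub>1 \<parallel>R\<^sub>k\<parallel>\<close> (\<open>rounding_error_le_result\<close>). The errors of the three products are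
  together at most \<open>\<gamma>\<^bsub>m+2s\<^esub> \<parallel>A\<parallel> \<parallel>Q\<parallel> \<parallel>\<alpha>\<parallel>\<close>, by the composition rule for the quantities \<open>\<gamma>\<^sub>k\<close>
  (\<open>gam_compose\<close>, \<open>residual_gap_step\<close>).

  The point of orthonormalising the directions is that \<open>\<parallel>Q\<parallel> \<parallel>\<alpha>\<parallel>\<close> cannot be much larger than the
  iterates. The computed \<open>Q\<close> is an exact matrix with orthonormal columns plus a perturbation of norm
  at most \<open>\<surd>s \<eta>\<close>, where \<open>\<eta>\<close> is the columnwise bound (\<open>computed_Q_factor_nearly_orthonormal\<close>).
  Hence \<open>\<parallel>Q\<parallel> \<le> \<surd>s (1 + \<eta>)\<close>, while \<open>\<alpha>\<close> is controlled by \<open>Q \<alpha>\<close> and therefore by the increment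
  \<open>X\<^sub>k - X\<^bsub>k-1\<^esub>\<close>. The roundoff condition is what makes the loss factor at most 2
  (\<open>orthonormality_loss_le_2\<close>), and \<open>u < 1/4\<close> bounds the computed increment by three times the largest
  iterate; so \<open>\<parallel>Q\<parallel> \<parallel>\<alpha>\<parallel> \<le> 6 \<surd>s max \<parallel>X\<^sub>i\<parallel>\<close> (\<open>coefficient_le_iterates\<close>). Summing over the steps gives
  the bound with 6 in place of 8 (and \<open>m + 2 s\<close> in place of \<open>m + 3 s\<close>), and when some iterate is
  nonzero, this difference makes the inequality strict.
\<close>

section \<open>Frobenius norm\<close>

lemma norm_matrix_sq_columns:
  fixes M :: "('r::finite, 'c::finite) rmat"
  shows "(norm M)\<^sup>2 = (\<Sum>j\<in>UNIV. (norm (column j M))\<^sup>2)"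
proof -
  have "(norm M)\<^sup>2 = (\<Sum>i\<in>UNIV. \<Sum>j\<in>UNIV. (M $ i $ j)\<^sup>2)"
    unfolding power2_norm_eq_inner inner_vec_def by (simp add: power2_eq_square)
  also have "\<dots> = (\<Sum>j\<in>UNIV. \<Sum>i\<in>UNIV. (M $ i $ j)\<^sup>2)"
    by (rule sum.swap)
  finally show ?thesis
    unfolding power2_norm_eq_inner[of "column _ M"] inner_vec_def[of "column _ M"]
    by (simp add: power2_eq_square column_def)
qed

lemma norm_matrix_le_columns:
  fixes M :: "('r::finite, 's::finite) rmat"
  assumes cols: "\<And>j. norm (column j M) \<le> e"
  shows "norm M \<le> sqrt CARD('s) * e"
proof -
  have "0 \<le> e"
    using order_trans[OF norm_ge_zero cols] .
  have "(norm M)\<^sup>2 \<le> (\<Sum>j\<in>(UNIV :: 's set). e\<^sup>2)"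
    unfolding norm_matrix_sq_columns by (intro sum_mono power_mono cols norm_ge_zero)
  also have "\<dots> = (sqrt CARD('s) * e)\<^sup>2"
    by (simp add: power_mult_distrib)
  finally show ?thesis
    by (rule power2_le_imp_le) (simp add: \<open>0 \<le> e\<close>)
qed

lemma matrix_add_rdistrib: "(M + N) ** C = M ** C + N ** C"
  by (vector matrix_matrix_mult_def sum.distrib[symmetric] field_simps)

lemma column_matrix_mult:
  fixes M :: "('r::finite, 'k::finite) rmat" and N :: "('k, 'c::finite) rmat"
  shows "column j (M ** N) = M *v column j N"
  by (simp add: column_def matrix_matrix_mult_def matrix_vector_mult_def vec_eq_iff)

lemma norm_matrix_vector_mult_le:
  fixes M :: "('r::finite, 'c::finite) rmat"
  shows "norm (M *v x) \<le> norm M * norm x"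
proof -
  have "(norm (M *v x))\<^sup>2 = (\<Sum>i\<in>UNIV. (M $ i \<bullet> x)\<^sup>2)"
    unfolding power2_norm_eq_inner inner_vec_def[of "M *v x"] matrix_vector_mul_component
    by (simp add: power2_eq_square)
  also have "\<dots> \<le> (\<Sum>i\<in>UNIV. (norm (M $ i) * norm x)\<^sup>2)"
    by (intro sum_mono abs_le_square_iff[THEN iffD1])
       (simp add: Cauchy_Schwarz_ineq2)
  also have "\<dots> = (norm M * norm x)\<^sup>2"
    by (simp add: power_mult_distrib power2_norm_eq_inner[of M] inner_vec_def[of M]
        sum_distrib_right power2_norm_eq_inner)
  finally show ?thesis
    by (rule power2_le_imp_le) simp
qed

lemma norm_matrix_mult_le:
  fixes M :: "('r::finite, 'k::finite) rmat" and N :: "('k, 'c::finite) rmat"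
  shows "norm (M ** N) \<le> norm M * norm N"
proof -
  have "(norm (M ** N))\<^sup>2 \<le> (\<Sum>j\<in>UNIV. (norm M * norm (column j N))\<^sup>2)"
    unfolding norm_matrix_sq_columns[of "M ** N"] column_matrix_mult
    by (intro sum_mono power_mono norm_matrix_vector_mult_le norm_ge_zero)
  also have "\<dots> = (norm M * norm N)\<^sup>2"
    by (simp add: power_mult_distrib norm_matrix_sq_columns[of N] sum_distrib_left)
  finally show ?thesis
    by (rule power2_le_imp_le) simp
qed

section \<open>Matrices with nearly orthonormal columns\<close>

text \<open>
  The matrix \<open>W\<close> is not assumed square, so that this covers the orthogonal factor as well as
  \<^const>\<open>id_over_zero\<close> and the product of the two.
\<close>

lemma norm_orthonormal_columns_mult:
  fixes W :: "('r::finite, 'k::finite) rmat" and M :: "('k, 'c::finite) rmat"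
  assumes "transpose W ** W = mat 1"
  shows "norm (W ** M) = norm M"
proof -
  have "norm (W *v x) = norm x" for x
  proof -
    have "(W *v x) \<bullet> (W *v x) = ((transpose W ** W) *v x) \<bullet> x"
      by (simp add: dot_lmul_matrix[symmetric] matrix_vector_mul_assoc[symmetric]
          transpose_matrix_vector inner_commute)
    then show ?thesis
      by (simp add: assms norm_eq)
  qed
  then have "(norm (W ** M))\<^sup>2 = (norm M)\<^sup>2"
    by (simp add: norm_matrix_sq_columns column_matrix_mult)
  then show ?thesis
    by simp
qed

lemma norm_orthonormal_columns:
  fixes W :: "('r::finite, 's::finite) rmat"
  assumes "transpose W ** W = mat 1"
  shows "norm W = sqrt CARD('s)"
proof -
  have "(norm (mat 1 :: ('s, 's) rmat))\<^sup>2 = real CARD('s)"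
    by (simp add: power2_norm_eq_inner inner_vec_def mat_def if_distrib[of "\<lambda>x. x * _"]
        cong: if_cong)
  moreover have "norm W = norm (mat 1 :: ('s, 's) rmat)"
    using norm_orthonormal_columns_mult[OF assms, of "mat 1"] by simp
  ultimately show ?thesis
    by (metis norm_ge_zero real_sqrt_unique)
qed

lemma pos_eq_iff: "pos i = pos j \<longleftrightarrow> i = j"
proof -
  have "pos i < pos j" if "i < j" for i j :: 'a
    unfolding pos_def using that by (intro psubset_card_mono) auto
  then show ?thesis
    by (metis less_irrefl neqE)
qed

lemma range_pos: "range (pos :: 'a::{finite,linorder} \<Rightarrow> nat) = {..<CARD('a)}"
proof (rule card_subset_eq)
  have "pos i < CARD('a)" for i :: 'a
    unfolding pos_def by (intro psubset_card_mono) auto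
  then show "range (pos :: 'a \<Rightarrow> nat) \<subseteq> {..<CARD('a)}"
    by auto
  show "card (range (pos :: 'a \<Rightarrow> nat)) = card {..<CARD('a)}"
    by (simp add: card_image inj_def pos_eq_iff)
qed simp

lemma id_over_zero_orthonormal:
  assumes "CARD('s::{finite,linorder}) \<le> CARD('n::{finite,linorder})"
  shows "transpose (id_over_zero :: ('n, 's) rmat) ** id_over_zero = mat 1"
proof -
  have "(\<Sum>i::'n\<in>UNIV. (if pos i = pos a then 1 else 0) * (if pos i = pos b then 1 else 0))
      = (if a = b then 1 else 0 :: real)" for a b :: 's
  proof -
    have "pos a \<in> range (pos :: 's \<Rightarrow> nat)"
      by simp
    then have "pos a \<in> range (pos :: 'n \<Rightarrow> nat)"
      using assms unfolding range_pos by auto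
    then obtain i0 :: 'n where i0: "pos a = pos i0"
      by auto
    have "(\<Sum>i::'n\<in>UNIV. (if pos i = pos a then 1 else 0) * (if pos i = pos b then 1 else 0))
        = (\<Sum>i\<in>UNIV. if i = i0 then (if pos a = pos b then 1 else 0) else (0::real))"
      by (rule sum.cong) (auto simp: i0 pos_eq_iff)
    then show ?thesis
      by (simp add: pos_eq_iff)
  qed
  then show ?thesis
    by (simp add: id_over_zero_def matrix_matrix_mult_def transpose_def mat_def vec_eq_iff)
qed

text \<open>
  The exact part is \<open>W = Q [I; O]\<close>, and \<open>E = Q \<Delta>\<close> has the norm of \<open>\<Delta>\<close> because \<open>Q\<close> is orthogonal; the
  factor \<open>\<surd>s\<close> is the price of passing from bounds on the \<open>s\<close> columns to the Frobenius norm.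
\<close>

lemma computed_Q_factor_nearly_orthonormal:
  fixes Qh :: "('n::{finite,linorder}, 's::{finite,linorder}) rmat"
  assumes "computed_Q_factor meth c u P Qh" and "CARD('s) \<le> CARD('n)"
  obtains W E where "Qh = W + E" and "transpose W ** W = mat 1"
    and "norm E \<le> sqrt CARD('s) * gam_tilde c u (q_error_index meth CARD('n) CARD('s))"
proof -
  obtain Q :: "('n, 'n) rmat" and \<Delta> where Q: "transpose Q ** Q = mat 1"
    and Qh: "Qh = Q ** (id_over_zero + \<Delta>)"
    and \<Delta>: "\<And>j. norm (column j \<Delta>) \<le> gam_tilde c u (q_error_index meth CARD('n) CARD('s))"
    using assms(1) unfolding computed_Q_factor_def full_Q_factor_def orthogonal_matrix by blast
  show ?thesis
  proof
    show "Qh = Q ** id_over_zero + Q ** \<Delta>"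
      by (simp add: Qh matrix_add_ldistrib)
    show "transpose (Q ** id_over_zero :: ('n, 's) rmat) ** (Q ** id_over_zero) = mat 1"
    proof -
      have "transpose (Q ** id_over_zero :: ('n, 's) rmat) ** (Q ** id_over_zero)
          = transpose id_over_zero ** (transpose Q ** Q) ** (id_over_zero :: ('n, 's) rmat)"
        by (simp only: matrix_transpose_mul matrix_mul_assoc)
      then show ?thesis
        by (simp add: Q id_over_zero_orthonormal[OF assms(2)])
    qed
    show "norm (Q ** \<Delta>)
        \<le> sqrt CARD('s) * gam_tilde c u (q_error_index meth CARD('n) CARD('s))"
      using norm_matrix_le_columns[OF \<Delta>] by (simp add: norm_orthonormal_columns_mult[OF Q])
  qed
qed

lemma nearly_orthonormal_bounds:
  fixes W E :: "('n::finite, 's::finite) rmat" and \<alpha> :: "('s, 's) rmat"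
  assumes W: "transpose W ** W = mat 1" and E: "norm E \<le> sqrt CARD('s) * \<eta>"
  shows "norm (W + E) \<le> sqrt CARD('s) * (1 + \<eta>)"
    and "(1 - sqrt CARD('s) * \<eta>) * norm \<alpha> \<le> norm ((W + E) ** \<alpha>)"
proof -
  have "norm (W + E) \<le> sqrt CARD('s) + sqrt CARD('s) * \<eta>"
    using norm_triangle_ineq[of W E] E norm_orthonormal_columns[OF W] by linarith
  then show "norm (W + E) \<le> sqrt CARD('s) * (1 + \<eta>)"
    by (simp only: distrib_left mult_1_right)
  have "norm \<alpha> = norm ((W + E) ** \<alpha> - E ** \<alpha>)"
    by (simp only: matrix_add_rdistrib add_diff_cancel_right' norm_orthonormal_columns_mult[OF W])
  also have "\<dots> \<le> norm ((W + E) ** \<alpha>) + norm (E ** \<alpha>)"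
    by (rule norm_triangle_ineq4)
  also have "norm (E ** \<alpha>) \<le> sqrt CARD('s) * \<eta> * norm \<alpha>"
    using E by (intro order_trans[OF norm_matrix_mult_le] mult_right_mono norm_ge_zero)
  finally show "(1 - sqrt CARD('s) * \<eta>) * norm \<alpha> \<le> norm ((W + E) ** \<alpha>)"
    by (simp add: left_diff_distrib)
qed

section \<open>Roundoff quantities\<close>

lemma gam_nonneg: "0 \<le> gam u k" if "0 \<le> u" "real k * u < 1"
  using that by (simp add: gam_def)

lemma gam_mono: "gam u i \<le> gam u j" if "0 \<le> u" "real j * u < 1" "i \<le> j"
proof -
  have "real i * u \<le> real j * u"
    using that by (simp add: mult_right_mono)
  then show ?thesis
    unfolding gam_def using that by (intro frac_le) auto
qed

text \<open>Since \<open>1 + \<gamma>\<^sub>k = 1 / (1 - k u)\<close>, this is \<open>(1 - i u) (1 - j u) \<ge> 1 - (i + j) u\<close>.\<close>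

lemma gam_compose:
  assumes "0 \<le> u" "real (i + j) * u < 1"
  shows "gam u i + gam u j + gam u i * gam u j \<le> gam u (i + j)"
proof -
  have le: "real i * u \<le> real (i + j) * u" "real j * u \<le> real (i + j) * u"
    using assms by (simp_all add: mult_right_mono)
  have one_plus: "1 + gam u k = 1 / (1 - real k * u)" if "real k * u < 1" for k
    using that by (simp add: gam_def field_simps)
  have "(1 + gam u i) * (1 + gam u j) = 1 / ((1 - real i * u) * (1 - real j * u))"
    using assms le by (simp add: one_plus)
  also have "\<dots> \<le> 1 / (1 - real (i + j) * u)"
  proof (rule divide_left_mono)
    have "0 \<le> (real i * u) * (real j * u)"
      using assms by simp
    then show "1 - real (i + j) * u \<le> (1 - real i * u) * (1 - real j * u)"
      by (simp add: algebra_simps)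
    show "0 < (1 - real i * u) * (1 - real j * u) * (1 - real (i + j) * u)"
      using assms le by (intro mult_pos_pos) linarith+
  qed simp
  also have "\<dots> = 1 + gam u (i + j)"
    using assms by (simp add: one_plus)
  finally show ?thesis
    by (simp add: algebra_simps)
qed

lemma max_row_nonzeros_le_card:
  fixes A :: "('r::finite, 'c::finite) rmat"
  shows "max_row_nonzeros A \<le> CARD('c)"
  unfolding max_row_nonzeros_def by (subst Max_le_iff) (auto intro: card_mono)

text \<open>
  With the error index \<open>a\<close> of the method, \<open>n + 2(s - 1) = a + s\<close> for Givens and
  \<open>(n + 1) s = a + s\<close> for Householder, so both roundoff conditions are the same in terms of \<open>a\<close>.
\<close>

lemma roundoff_condition_iff:
  assumes "1 \<le> s" "s \<le> n"
  shows "roundoff_condition meth n s c u \<longleftrightarrow>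
    real c * ((real (q_error_index meth n s) + real s) * (sqrt s + 1) + 1) * u < 1 / 2"
proof (cases meth)
  case Givens
  have "real (n + s - 2) = real n + real s - 2"
    using assms by linarith
  then show ?thesis
    by (simp add: Givens algebra_simps)
next
  case Householder
  then show ?thesis
    by (simp add: algebra_simps)
qed

text \<open>
  The roundoff condition makes \<open>4 (a + s) u\<close> less than \<open>1 / 2\<close>, because \<open>c \<ge> 2\<close> and \<open>\<surd>s + 1 \<ge> 2\<close>, and
  \<open>m \<le> n \<le> a + s\<close> for both methods.
\<close>

lemma roundoff_condition_small:
  assumes "1 \<le> s" "s \<le> n" "m \<le> n" "0 < u" "1 < c" "roundoff_condition meth n s c u"
  shows "real (m + 3 * s) * u < 1 / 2" and "u < 1 / 4"
proof -
  let ?a = "q_error_index meth n s"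
  have "n \<le> ?a + s"
    using assms(1,2) by (cases meth) (auto simp: trans_le_add1)
  then have "m + 3 * s \<le> (?a + s) + 3 * s"
    using assms(3) by simp
  also have "\<dots> \<le> 4 * (?a + s)"
    by simp
  finally have "real (m + 3 * s) \<le> 4 * (real ?a + real s)"
    by (metis of_nat_add of_nat_le_iff of_nat_mult of_nat_numeral)
  also have "\<dots> = 2 * ((real ?a + real s) * 2)"
    by simp
  also have "\<dots> \<le> real c * ((real ?a + real s) * (sqrt s + 1) + 1)"
  proof (rule mult_mono)
    have "(real ?a + real s) * 2 \<le> (real ?a + real s) * (sqrt s + 1)"
      using assms(1) by (intro mult_left_mono) auto
    then show "(real ?a + real s) * 2 \<le> (real ?a + real s) * (sqrt s + 1) + 1"
      by linarith
  qed (use assms(5) in auto)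
  finally have "real (m + 3 * s) * u \<le> real c * ((real ?a + real s) * (sqrt s + 1) + 1) * u"
    using assms(4) by (intro mult_right_mono) auto
  moreover have "2 * u \<le> real c * ((real ?a + real s) * (sqrt s + 1) + 1) * u"
  proof (rule mult_right_mono)
    have "2 * 1 \<le> real c * ((real ?a + real s) * (sqrt s + 1) + 1)"
      using assms(5) by (intro mult_mono) auto
    then show "2 \<le> real c * ((real ?a + real s) * (sqrt s + 1) + 1)"
      by simp
  qed (use assms(4) in simp)
  moreover have "real c * ((real ?a + real s) * (sqrt s + 1) + 1) * u < 1 / 2"
    using assms roundoff_condition_iff by blast
  ultimately show "real (m + 3 * s) * u < 1 / 2" and "u < 1 / 4"
    by linarith+
qed

text \<open>
  Up to the factor \<open>\<surd>s\<close>, the norm of \<open>Q\<close> is at most \<open>1 + \<eta>\<close>; the factor in parentheses is the least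
  ratio of the computed \<open>Q \<alpha>\<close> to \<open>\<alpha>\<close> in norm that the error bounds guarantee. With \<open>t = c a u\<close>,
  where \<open>a\<close> is the error index, one has \<open>1 + \<eta> = 1 / (1 - t)\<close>, so the claim is
  \<open>(\<surd>s + 1) t + \<surd>s \<gamma>\<^sub>s \<le> 1 / 2\<close>; and \<open>\<gamma>\<^sub>s \<le> 2 s u \<le> c s u\<close>.
\<close>

lemma orthonormality_loss_le_2:
  fixes s n c :: nat and u :: real
  assumes sn: "1 \<le> s" "s \<le> n" and u: "0 < u" and c: "1 < c"
    and roundoff: "roundoff_condition meth n s c u"
  defines "\<eta> \<equiv> gam_tilde c u (q_error_index meth n s)"
  shows "0 \<le> \<eta>" and "1 + \<eta> \<le> 2 * (1 - sqrt s * \<eta> - gam u s * (sqrt s * (1 + \<eta>)))"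
proof -
  define t where "t = real c * real (q_error_index meth n s) * u"
  define w where "w = sqrt (real s)"
  have w: "1 \<le> w"
    using sn by (simp add: w_def)
  have t: "0 \<le> t"
    using u by (simp add: t_def)
  have cond: "t * (w + 1) + real c * real s * u * (w + 1) + real c * u < 1 / 2"
    using roundoff unfolding roundoff_condition_iff[OF sn]
    by (simp add: t_def w_def algebra_simps)
  have su: "real s * u < 1 / 2"
    using roundoff_condition_small(1)[of s n 0 u c meth] assms u by (simp add: algebra_simps)
  have "real s * u / (1 - real s * u) \<le> real s * u / (1 / 2)"
    using su u by (intro divide_left_mono) auto
  then have "gam u s \<le> 2 * (real s * u)"
    by (simp add: gam_def)
  also have "\<dots> \<le> real c * (real s * u)"
    using c u by (intro mult_right_mono) auto
  finally have gam_le: "gam u s \<le> real c * real s * u"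
    by simp
  have "w * gam u s \<le> (w + 1) * (real c * real s * u)"
    using w gam_le u by (intro mult_mono) (auto simp: gam_nonneg su order.strict_trans[OF su])
  moreover have "0 \<le> real c * u"
    using u by simp
  ultimately have key: "(w + 1) * t + w * gam u s \<le> 1 / 2"
    using cond by (simp add: algebra_simps)
  moreover have "0 \<le> w * gam u s"
    using w u su by (simp add: gam_nonneg)
  moreover have "t \<le> (w + 1) * t"
    using w t mult_right_mono[of 1 "w + 1" t] by simp
  ultimately have t1: "t < 1"
    by linarith
  have \<eta>: "\<eta> = t / (1 - t)"
    by (simp add: \<eta>_def gam_tilde_def t_def)
  then show "0 \<le> \<eta>"
    using t t1 by simp
  have one_plus: "1 + \<eta> = 1 / (1 - t)"
    using t1 by (simp add: \<eta> field_simps)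
  have "1 \<le> 2 * ((1 - t) - w * t - gam u s * w)"
    using key by (simp add: algebra_simps)
  then have "1 / (1 - t) \<le> 2 * ((1 - t) - w * t - gam u s * w) / (1 - t)"
    using t1 by (intro divide_right_mono) auto
  also have "\<dots> = 2 * ((1 - t) / (1 - t) - w * (t / (1 - t)) - gam u s * (w * (1 / (1 - t))))"
    by (simp only: diff_divide_distrib times_divide_eq_right mult_1_right right_diff_distrib)
  also have "\<dots> = 2 * (1 - w * \<eta> - gam u s * (w * (1 / (1 - t))))"
    using t1 by (simp add: \<eta>)
  finally show "1 + \<eta> \<le> 2 * (1 - sqrt s * \<eta> - gam u s * (sqrt s * (1 + \<eta>)))"
    unfolding one_plus w_def .
qed

section \<open>One step of the recursions\<close>

text \<open>
  The error model bounds the error of an addition by the exact sum; the bound of the theorem is in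
  terms of the computed one. As \<open>\<parallel>Y\<parallel> \<le> \<parallel>Y + E\<parallel> + u \<parallel>Y\<parallel>\<close>, the change costs a factor \<open>1 / (1 - u)\<close>.
\<close>

lemma rounding_error_le_result:
  fixes Y E :: "'a::real_normed_vector"
  assumes "norm E \<le> u * norm Y" "0 \<le> u" "u < 1"
  shows "norm Y \<le> norm (Y + E) / (1 - u)" and "norm E \<le> gam u 1 * norm (Y + E)"
proof -
  have "norm Y \<le> norm (Y + E) + norm E"
    using norm_triangle_ineq4[of "Y + E" E] by simp
  then show Y: "norm Y \<le> norm (Y + E) / (1 - u)"
    using assms by (simp add: field_simps)
  show "norm E \<le> gam u 1 * norm (Y + E)"
    using assms(1) mult_left_mono[OF Y assms(2)] by (simp add: gam_def)
qed

text \<open>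
  The exact updates cancel in the residual gap, so the new gap is the old one plus
  \<open>- A E\<^sub>1 - A E\<^sub>2 + E\<^sub>3 \<alpha> + E\<^sub>4 - E\<^sub>5\<close>. The product errors \<open>E\<^sub>1\<close>, \<open>E\<^sub>3\<close> and \<open>E\<^sub>4\<close> contribute
  \<open>\<gamma>\<^sub>s\<close>, \<open>\<gamma>\<^sub>m\<close> and \<open>\<gamma>\<^sub>s (1 + \<gamma>\<^sub>m)\<close> times \<open>\<parallel>A\<parallel> \<parallel>Q\<parallel> \<parallel>\<alpha>\<parallel>\<close>, which compose to \<open>\<gamma>\<^bsub>m+2s\<^esub>\<close>.
\<close>

lemma residual_gap_step:
  fixes A :: "('n::finite, 'n) rmat" and X R Q B :: "('n, 's::finite) rmat"
    and \<alpha> :: "('s, 's) rmat"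
  assumes X': "X' = X + (Q ** \<alpha> + E1) + E2"
    and R': "R' = R - ((A ** Q + E3) ** \<alpha> + E4) + E5"
    and E1: "norm E1 \<le> gam u s * norm Q * norm \<alpha>"
    and E2: "norm E2 \<le> gam u 1 * norm X'"
    and E3: "norm E3 \<le> gam u m * norm A * norm Q"
    and E4: "norm E4 \<le> gam u s * norm (A ** Q + E3) * norm \<alpha>"
    and E5: "norm E5 \<le> gam u 1 * norm R'"
    and u: "0 \<le> u" "real (m + 2 * s) * u < 1"
  shows "norm (residual_gap A B X' R') \<le> norm (residual_gap A B X R)
    + gam u (m + 2 * s) * norm A * (norm Q * norm \<alpha>)
    + gam u 1 * norm A * norm X' + gam u 1 * norm R'"
proof -
  have small: "real s * u < 1" "real m * u < 1" "real (m + s) * u < 1"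
    using u mult_right_mono[of "real s" "real (m + 2 * s)" u]
      mult_right_mono[of "real m" "real (m + 2 * s)" u]
      mult_right_mono[of "real (m + s)" "real (m + 2 * s)" u] by simp_all
  let ?g = "norm A * (norm Q * norm \<alpha>)"
  have "residual_gap A B X' R'
      = residual_gap A B X R + (- (A ** E1) - A ** E2 + E3 ** \<alpha> + E4 - E5)"
    by (simp add: residual_gap_def X' R' matrix_add_ldistrib matrix_add_rdistrib matrix_mul_assoc)
  then have "norm (residual_gap A B X' R') \<le> norm (residual_gap A B X R)
      + (norm (A ** E1) + norm (A ** E2) + norm (E3 ** \<alpha>) + norm E4 + norm E5)"
    by (smt (verit) norm_minus_cancel norm_triangle_ineq norm_triangle_ineq4)
  moreover have "norm (A ** E1) \<le> gam u s * ?g"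
    using norm_matrix_mult_le[of A E1] mult_left_mono[OF E1, of "norm A"]
    by (simp add: algebra_simps)
  moreover have "norm (A ** E2) \<le> gam u 1 * norm A * norm X'"
    using norm_matrix_mult_le[of A E2] mult_left_mono[OF E2, of "norm A"]
    by (simp add: algebra_simps)
  moreover have "norm (E3 ** \<alpha>) \<le> gam u m * ?g"
    using norm_matrix_mult_le[of E3 \<alpha>] mult_right_mono[OF E3, of "norm \<alpha>"]
    by (simp add: algebra_simps)
  moreover have "norm E4 \<le> gam u s * (1 + gam u m) * ?g"
  proof -
    have "norm (A ** Q + E3) \<le> (1 + gam u m) * (norm A * norm Q)"
      using norm_triangle_ineq[of "A ** Q" E3] norm_matrix_mult_le[of A Q] E3
      by (simp add: algebra_simps)
    then have "gam u s * norm (A ** Q + E3) * norm \<alpha>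
        \<le> gam u s * ((1 + gam u m) * (norm A * norm Q)) * norm \<alpha>"
      using gam_nonneg[OF u(1) small(1)] by (intro mult_right_mono mult_left_mono) auto
    then show ?thesis
      using E4 by (simp add: algebra_simps)
  qed
  ultimately have "norm (residual_gap A B X' R') \<le> norm (residual_gap A B X R)
      + (gam u s + gam u m + gam u s * (1 + gam u m)) * ?g
      + gam u 1 * norm A * norm X' + gam u 1 * norm R'"
    using E5 by (simp add: algebra_simps)
  moreover have "(gam u s + gam u m + gam u s * (1 + gam u m)) * ?g \<le> gam u (m + 2 * s) * ?g"
  proof (rule mult_right_mono)
    have "gam u s + gam u m + gam u s * (1 + gam u m) \<le> gam u (m + s) + gam u s"
      using gam_compose[OF u(1) small(3)] by (simp add: algebra_simps)
    also have "\<dots> \<le> gam u (m + s) + gam u s + gam u (m + s) * gam u s"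
      using gam_nonneg[OF u(1)] small by simp
    also have "\<dots> \<le> gam u (m + s + s)"
      using u by (intro gam_compose) (simp_all add: algebra_simps)
    also have "m + s + s = m + 2 * s"
      by simp
    finally show "gam u s + gam u m + gam u s * (1 + gam u m) \<le> gam u (m + 2 * s)" .
  qed simp
  ultimately show ?thesis
    by (simp add: algebra_simps)
qed

text \<open>
  The computed increment \<open>Q \<alpha> + E\<^sub>1\<close> is at most \<open>\<parallel>X\<parallel> + \<parallel>X'\<parallel> / (1 - u) \<le> 3 M\<close> in norm, and it is at
  least \<open>(1 - \<surd>s \<eta> - \<gamma>\<^sub>s \<surd>s (1 + \<eta>)) \<parallel>\<alpha>\<parallel>\<close>, as \<open>Q\<close> nearly preserves norms.
\<close>

lemma coefficient_le_iterates:
  fixes X X' Q E1 E2 P :: "('n::{finite,linorder}, 's::{finite,linorder}) rmat"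
    and \<alpha> :: "('s, 's) rmat"
  assumes Q: "computed_Q_factor meth c u P Q"
    and sn: "CARD('s) \<le> CARD('n)" and u: "0 < u" and c: "1 < c"
    and roundoff: "roundoff_condition meth CARD('n) CARD('s) c u"
    and X': "X' = X + (Q ** \<alpha> + E1) + E2"
    and E1: "norm E1 \<le> gam u CARD('s) * norm Q * norm \<alpha>"
    and E2: "norm E2 \<le> u * norm (X + (Q ** \<alpha> + E1))"
    and M: "norm X \<le> M" "norm X' \<le> M"
  shows "norm Q * norm \<alpha> \<le> 6 * sqrt CARD('s) * M"
proof -
  define \<eta> where "\<eta> = gam_tilde c u (q_error_index meth CARD('n) CARD('s))"
  define w where "w = sqrt (real CARD('s))"
  define D where "D = 1 - w * \<eta> - gam u CARD('s) * (w * (1 + \<eta>))"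
  have s1: "1 \<le> CARD('s)"
    by (simp add: Suc_leI)
  have \<eta>: "0 \<le> \<eta>" "1 + \<eta> \<le> 2 * D"
    using orthonormality_loss_le_2[OF s1 sn u c roundoff] by (simp_all add: \<eta>_def D_def w_def)
  have u4: "u < 1 / 4" and su: "real (3 * CARD('s)) * u < 1 / 2"
    using roundoff_condition_small[OF s1 sn _ u c roundoff, of 0] by simp_all
  have gam_s: "0 \<le> gam u CARD('s)"
    using su u by (intro gam_nonneg) auto
  obtain W E where W: "Q = W + E" "transpose W ** W = mat 1" "norm E \<le> w * \<eta>"
    using computed_Q_factor_nearly_orthonormal[OF Q sn] by (auto simp: \<eta>_def w_def)
  have nQ: "norm Q \<le> w * (1 + \<eta>)" and Q\<alpha>: "(1 - w * \<eta>) * norm \<alpha> \<le> norm (Q ** \<alpha>)"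
    using nearly_orthonormal_bounds[OF W(2), of E \<eta>] W(1,3) by (simp_all add: w_def)
  have "gam u CARD('s) * norm Q * norm \<alpha> \<le> gam u CARD('s) * (w * (1 + \<eta>)) * norm \<alpha>"
    using nQ gam_s by (intro mult_right_mono mult_left_mono) auto
  then have "D * norm \<alpha> \<le> norm (Q ** \<alpha>) - norm E1"
    using Q\<alpha> E1 by (simp add: D_def algebra_simps)
  also have "\<dots> \<le> norm (Q ** \<alpha> + E1)"
    using norm_triangle_ineq4[of "Q ** \<alpha> + E1" E1] by simp
  also have "\<dots> \<le> norm (X + (Q ** \<alpha> + E1)) + norm X"
    using norm_triangle_ineq4[of "X + (Q ** \<alpha> + E1)" X] by simp
  also have "\<dots> \<le> 2 * M + M"
  proof -
    have "norm (X + (Q ** \<alpha> + E1)) \<le> norm X' / (1 - u)"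
      using rounding_error_le_result(1)[OF E2] u u4 by (simp add: X')
    also have "\<dots> \<le> norm X' / (1 / 2)"
      using u4 by (intro divide_left_mono) auto
    also have "\<dots> = 2 * norm X'"
      by simp
    finally show ?thesis
      using M by linarith
  qed
  finally have D\<alpha>: "D * norm \<alpha> \<le> 3 * M"
    by simp
  have "norm Q * norm \<alpha> \<le> w * (1 + \<eta>) * norm \<alpha>"
    using nQ by (intro mult_right_mono) auto
  also have "\<dots> \<le> w * (2 * D) * norm \<alpha>"
    using \<eta>(2) by (intro mult_right_mono mult_left_mono) (auto simp: w_def)
  also have "\<dots> = 2 * w * (D * norm \<alpha>)"
    by simp
  also have "\<dots> \<le> 2 * w * (3 * M)"
    using D\<alpha> by (intro mult_left_mono) (auto simp: w_def)
  finally show ?thesis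
    by (simp add: w_def)
qed

section \<open>The bound for the residual gap\<close>

theorem theorem4p1:
  fixes A :: "('n::{finite,linorder}, 'n) rmat"
    and B :: "('n, 's::{finite,linorder}) rmat"
    and F :: "real set" and u :: real and c n s m k :: nat
    and fl_add fl_sub :: "('n, 's) rmat \<Rightarrow> ('n, 's) rmat \<Rightarrow> ('n, 's) rmat"
    and fl_mul :: "('n, 's) rmat \<Rightarrow> ('s, 's) rmat \<Rightarrow> ('n, 's) rmat"
    and fl_lmul :: "('n, 's) rmat \<Rightarrow> ('n, 's) rmat"
    and meth :: qr_method
    and P Qh X R :: "nat \<Rightarrow> ('n, 's) rmat"
    and \<alpha> :: "nat \<Rightarrow> ('s, 's) rmat"
  assumes n: "n = CARD('n)" and s: "s = CARD('s)" and s_le_n: "s \<le> n"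
    and nonsingular: "invertible A"
    and m: "m = max_row_nonzeros A"
    and zero_in_F: "0 \<in> F"
    and u_pos: "0 < u"
    and c_gt_1: "1 < c"
    and fl: "fl_error_model F u A B fl_add fl_sub fl_mul fl_lmul"
    and alpha_fp: "\<And>j. \<alpha> j \<in> fp_matrices F"
    and Qh_fp: "\<And>j. Qh j \<in> fp_matrices F"
    and Qh: "\<And>j. computed_Q_factor meth c u (P j) (Qh j)"
    and X_0: "X 0 = 0"
    and R_0: "R 0 = B - A ** X 0"
    and X_Suc: "\<And>j. X (Suc j) = fl_add (X j) (fl_mul (Qh j) (\<alpha> j))"
    and R_Suc: "\<And>j. R (Suc j) = fl_sub (R j) (fl_mul (fl_lmul (Qh j)) (\<alpha> j))"
    and roundoff: "roundoff_condition meth n s c u"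
    and k: "1 \<le> k"
  shows "let bound = (8 * sqrt (real s) * gam u (m + 3 * s) + gam u 1) * real k * norm A
                        * (MAX i\<in>{0<..k}. norm (X i))
                      + real k * gam u 1 * (MAX i\<in>{0<..k}. norm (R i))
         in ((\<exists>i\<in>{0<..k}. X i \<noteq> 0) \<longrightarrow> norm (residual_gap A B (X k) (R k)) < bound)
            \<and> norm (residual_gap A B (X k) (R k)) \<le> bound"
proof -
  define MX where "MX = (MAX i\<in>{0<..k}. norm (X i))"
  define MR where "MR = (MAX i\<in>{0<..k}. norm (R i))"
  have s1: "1 \<le> s"
    by (simp add: s Suc_leI)
  have sn: "CARD('s) \<le> CARD('n)" and roundoff': "roundoff_condition meth CARD('n) CARD('s) c u"
    using s_le_n roundoff unfolding n s by simp_all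
  have m_le_n: "m \<le> n"
    unfolding m n by (rule max_row_nonzeros_le_card)
  have small: "real (m + 3 * s) * u < 1 / 2" "u < 1 / 4"
    using roundoff_condition_small[OF s1 s_le_n m_le_n u_pos c_gt_1 roundoff] by simp_all
  have small2: "real (m + 2 * s) * u < 1"
  proof -
    have "real (m + 2 * s) * u \<le> real (m + 3 * s) * u"
      using u_pos by (intro mult_right_mono) auto
    then show ?thesis
      using small(1) by linarith
  qed
  have norm_X: "norm (X i) \<le> MX" if "0 < i" "i \<le> k" for i
    unfolding MX_def using that by (intro Max_ge) auto
  have norm_R: "norm (R i) \<le> MR" if "0 < i" "i \<le> k" for i
    unfolding MR_def using that by (intro Max_ge) auto
  have MX_nonneg: "0 \<le> MX"
    using norm_X[of k] k norm_ge_zero[of "X k"] by linarith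
  have g1: "0 \<le> gam u 1"
    using small(2) u_pos by (intro gam_nonneg) auto
  note model = fl[unfolded fl_error_model_def]
  have mul_fp: "fl_mul Y (\<alpha> j) \<in> fp_matrices F" if "Y \<in> fp_matrices F" for Y j
    using model that alpha_fp[of j] by blast
  have lmul_fp: "fl_lmul (Qh j) \<in> fp_matrices F" for j
    using model Qh_fp[of j] by blast
  have X_fp: "X j \<in> fp_matrices F" for j
  proof (induction j)
    case 0
    show ?case
      using zero_in_F by (simp add: X_0 fp_matrices_def)
  next
    case (Suc j)
    then show ?case
      using model mul_fp[OF Qh_fp] by (simp add: X_Suc)
  qed
  have R0: "R 0 = B"
    by (simp add: R_0 X_0 matrix_matrix_mult_def vec_eq_iff)
  have R_fp: "R j \<in> insert B (fp_matrices F)" for j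
  proof (induction j)
    case 0
    show ?case
      by (simp add: R0)
  next
    case (Suc j)
    then show ?case
      using model mul_fp[OF lmul_fp] unfolding R_Suc by blast
  qed

  define step where "step = 6 * sqrt (real s) * gam u (m + 2 * s) * norm A * MX
    + gam u 1 * norm A * MX + gam u 1 * MR"
  have step: "norm (residual_gap A B (X (Suc j)) (R (Suc j)))
      \<le> norm (residual_gap A B (X j) (R j)) + step" if j: "Suc j \<le> k" for j
  proof -
    obtain E1 where E1: "fl_mul (Qh j) (\<alpha> j) = Qh j ** \<alpha> j + E1"
        "norm E1 \<le> gam u s * norm (Qh j) * norm (\<alpha> j)"
      using model Qh_fp[of j] alpha_fp[of j] s by blast
    obtain E2 where E2: "X (Suc j) = X j + (Qh j ** \<alpha> j + E1) + E2"
        "norm E2 \<le> u * norm (X j + (Qh j ** \<alpha> j + E1))"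
      using model X_fp[of j] mul_fp[OF Qh_fp, of j j] unfolding X_Suc E1(1) by blast
    obtain E3 where E3: "fl_lmul (Qh j) = A ** Qh j + E3"
        "norm E3 \<le> gam u m * norm A * norm (Qh j)"
      using model Qh_fp[of j] m by blast
    obtain E4 where E4: "fl_mul (fl_lmul (Qh j)) (\<alpha> j) = (A ** Qh j + E3) ** \<alpha> j + E4"
        "norm E4 \<le> gam u s * norm (A ** Qh j + E3) * norm (\<alpha> j)"
      using model lmul_fp[of j] alpha_fp[of j] s unfolding E3(1) by blast
    obtain E5 where E5: "R (Suc j) = R j - ((A ** Qh j + E3) ** \<alpha> j + E4) + E5"
        "norm E5 \<le> u * norm (R j - ((A ** Qh j + E3) ** \<alpha> j + E4))"
      using model R_fp[of j] mul_fp[OF lmul_fp, of j j] unfolding R_Suc E4(1) by blast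
    have u1: "0 \<le> u" "u < 1"
      using u_pos small(2) by simp_all
    have E2': "norm E2 \<le> gam u 1 * norm (X (Suc j))"
      using rounding_error_le_result(2)[OF E2(2) u1] by (simp add: E2(1))
    have E5': "norm E5 \<le> gam u 1 * norm (R (Suc j))"
      using rounding_error_le_result(2)[OF E5(2) u1] by (simp add: E5(1))
    \<comment> \<open>The maximum starts at index 1; the index 0 is harmless because \<open>X 0 = 0\<close>.\<close>
    have X_j: "norm (X j) \<le> MX"
      using norm_X[of j] j MX_nonneg by (cases "j = 0") (auto simp: X_0)
    have X_Sj: "norm (X (Suc j)) \<le> MX" and R_Sj: "norm (R (Suc j)) \<le> MR"
      using norm_X norm_R j by simp_all
    have "norm (Qh j) * norm (\<alpha> j) \<le> 6 * sqrt CARD('s) * MX"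
      using E1(2) X_j X_Sj
      by (intro coefficient_le_iterates[OF Qh sn u_pos c_gt_1 roundoff' E2(1) _ E2(2)])
         (simp_all add: s)
    then have "gam u (m + 2 * s) * norm A * (norm (Qh j) * norm (\<alpha> j))
        \<le> gam u (m + 2 * s) * norm A * (6 * sqrt (real s) * MX)"
      using gam_nonneg[OF u1(1) small2] by (intro mult_left_mono) (auto simp: s)
    moreover have "gam u 1 * norm A * norm (X (Suc j)) \<le> gam u 1 * norm A * MX"
      using X_Sj g1 by (intro mult_left_mono) auto
    moreover have "gam u 1 * norm (R (Suc j)) \<le> gam u 1 * MR"
      using R_Sj g1 by (intro mult_left_mono)
    ultimately show ?thesis
      using residual_gap_step[OF E2(1) E5(1) E1(2) E2' E3(2) E4(2) E5' u1(1) small2, of B]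
      by (simp add: step_def algebra_simps)
  qed
  have "norm (residual_gap A B (X j) (R j)) \<le> real j * step" if "j \<le> k" for j
    using that
  proof (induction j)
    case 0
    show ?case
      by (simp add: residual_gap_def R_0)
  next
    case (Suc j)
    then show ?case
      using step[of j] by (simp add: algebra_simps)
  qed
  then have gap: "norm (residual_gap A B (X k) (R k)) \<le> real k * step"
    by simp

  define bound where "bound = (8 * sqrt (real s) * gam u (m + 3 * s) + gam u 1) * real k * norm A * MX
    + real k * gam u 1 * MR"
  \<comment> \<open>The coefficient by which the claimed bound exceeds the accumulated steps.\<close>
  define g where "g = 8 * sqrt (real s) * gam u (m + 3 * s) - 6 * sqrt (real s) * gam u (m + 2 * s)"
  have bound_eq: "bound = real k * step + g * (real k * norm A * MX)"
    by (simp add: bound_def step_def g_def algebra_simps)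
  have g: "0 < g"
  proof -
    have "gam u (m + 2 * s) \<le> gam u (m + 3 * s)"
      using small(1) u_pos by (intro gam_mono) auto
    moreover have "0 < gam u (m + 3 * s)"
      using small(1) u_pos s1 by (simp add: gam_def)
    ultimately have "6 * gam u (m + 2 * s) < 8 * gam u (m + 3 * s)"
      by linarith
    then have "sqrt (real s) * (6 * gam u (m + 2 * s)) < sqrt (real s) * (8 * gam u (m + 3 * s))"
      using s1 by (intro mult_strict_left_mono) auto
    then show ?thesis
      by (simp add: g_def)
  qed
  have "norm (residual_gap A B (X k) (R k)) \<le> bound"
    using gap g MX_nonneg by (simp add: bound_eq add_increasing2)
  moreover have "norm (residual_gap A B (X k) (R k)) < bound" if nonzero: "\<exists>i\<in>{0<..k}. X i \<noteq> 0"
  proof -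
    obtain i where "i \<in> {0<..k}" "X i \<noteq> 0"
      using nonzero by blast
    then have "0 < MX"
      using norm_X[of i] zero_less_norm_iff[of "X i"] by (simp del: zero_less_norm_iff)
    moreover have "A \<noteq> 0"
    proof
      assume "A = 0"
      then have "(0 :: ('n, 'n) rmat) = mat 1"
        using nonsingular by (auto simp: invertible_def matrix_matrix_mult_def zero_vec_def)
      then show False
        by (simp add: mat_def vec_eq_iff) (metis zero_neq_one)
    qed
    ultimately have "0 < g * (real k * norm A * MX)"
      using g k by simp
    then show ?thesis
      using gap by (simp add: bound_eq)
  qed
  ultimately show ?thesis
    unfolding Let_def bound_def MX_def MR_def by blast
qed

end
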